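(* Let $\alpha_{2,3}=\sum_{n\geqslant 1}\frac{1}{3^n2^{3^n}}$, and let its base-$4$ expansion be given by $\alpha_{2,3}=\sum_{k\geqslant 1}d_k4^{-k}$, with $d_k\in\{0,1,2,3\}$. Then for all integers $n\geqslant 0$ one has (i) $$\sum_{k=\frac{3}{2}(3^n+1)}^{\frac{3}{2}(3^n+1)+3^n-1}\left(e^{\frac{\pi i}{2}}\right)^{d_k}=-\begin{cases} i, & \text{if } n \text{ is odd}\\ 1, & \text{if } n \text{ is even};\end{cases}$$ (ii) $d_k=d_{3^n+k}=d_{2\cdot 3^n+k}$ for $k=\frac{3}{2}(3^n+1),\frac{3}{2}(3^n+1)+1,\ldots,\frac{3}{2}(3^n+1)+3^n-1$.
   Context: Here $i$ denotes the imaginary unit. The number $\alpha_{2,3}$ is the Stoneham number with parameters $b=2$, $c=3$; in general, for coprime integers $b,c\geqslant 2$, $\alpha_{b,c}=\sum_{n\geqslant 1}\frac{1}{c^nb^{c^n}}$. The base-$4$ expansion is the usual digit expansion. *)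

theory Defs
  imports Complex_Main
begin

text \<open>
  The sums over \<open>n \<ge> 1\<close> and \<open>k \<ge> 1\<close> are written as series over all naturals with the index
  shifted by one.
\<close>

definition stoneham :: "nat \<Rightarrow> nat \<Rightarrow> real" where
  "stoneham b c = (\<Sum>n. 1 / (real c ^ Suc n * real b ^ (c ^ Suc n)))"

text \<open>
  \<open>d k\<close> is the digit of weight \<open>b\<^sup>-\<^sup>k\<close> for \<open>k \<ge> 1\<close>; the value \<open>d 0\<close> carries no meaning. Expansions
  ending in \<open>b - 1\<close> repeated forever are not excluded; this matters only for numbers that also
  have a terminating expansion.
\<close>

definition is_expansion :: "nat \<Rightarrow> real \<Rightarrow> (nat \<Rightarrow> nat) \<Rightarrow> bool" where
  "is_expansion b x d \<longleftrightarrow>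
     (\<forall>k\<ge>1. d k \<in> {0..<b}) \<and> (\<lambda>k. real (d (Suc k)) / real b ^ Suc k) sums x"

text \<open>The division by two in the starting index is exact.\<close>

definition block_start :: "nat \<Rightarrow> nat" where
  "block_start n = 3 * (3 ^ n + 1) div 2"

lemma two_times_block_start: "2 * block_start n = 3 * (3 ^ n + 1)"
  unfolding block_start_def by simp

end

theory Submission
  imports Defs
begin

text \<open>
  Write \<open>\<alpha>\<close> for the Stoneham number, and \<open>k = block_start n + i\<close> with \<open>i < 3 ^ (n + 1)\<close>; these \<open>k\<close> are
  exactly the positions for which \<open>4 ^ (k - 1)\<close> lies between \<open>2 ^ 3 ^ (n + 1)\<close> and
  \<open>2 ^ 3 ^ (n + 2)\<close>. Multiplying \<open>\<alpha>\<close> by \<open>4 ^ (k - 1)\<close> therefore clears the powers of two from the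
  first \<open>n + 1\<close> terms of the series, whose sum becomes \<open>A * 4 ^ i / 3 ^ (n + 1)\<close> for one integer
  \<open>A\<close>, while the remaining terms are still so small that they never carry into the digit:
  after multiplication by 4 they stay below \<open>1 / 3 ^ (n + 1)\<close>, and a fraction with denominator
  \<open>3 ^ (n + 1)\<close> is at least that far from the next larger integer. So the digit is the leading base-4
  digit of the fraction \<open>r / 3 ^ (n + 1)\<close>, where \<open>r\<close> is the residue of \<open>A * 4 ^ i\<close>
  (lemma \<open>block_digit\<close>).

  Everything else is arithmetic of the powers of 4 modulo \<open>3 ^ (n + 1)\<close>. Their period is exactly
  \<open>3 ^ n\<close> (lemma \<open>power_3_dvd_power_4_minus_1_iff\<close>). This gives the threefold repetition of the
  digits in a block. It also shows that over one period the residues \<open>r\<close> are pairwise distinct;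
  they are all congruent to \<open>A\<close>, that is to 2, modulo 3, and there are \<open>3 ^ n\<close> of them, so they are
  all the numbers \<open>3 * j + 2\<close> below \<open>3 ^ (n + 1)\<close>
  (lemma \<open>sum_residues_times_powers_of_4\<close>). Only the number of these in each quarter of the
  interval up to \<open>3 ^ (n + 1)\<close> matters for the exponential sum: the four counts are equal except
  that the digit 2 occurs once more than the others if \<open>3 ^ n\<close> is 1 modulo 4, and the digit 1
  once less if \<open>3 ^ n\<close> is 3 modulo 4 (lemma \<open>sum_i_power_quartiles\<close>). Since the four powers of
  \<open>\<i>\<close> sum to 0, what is left is \<open>\<i>\<^sup>2 = -1\<close> or \<open>-\<i>\<close>.
\<close>

section \<open>Reading a digit off the integer part\<close>

text \<open>
  Strict inequality on both sides means that \<open>b ^ k * x\<close> is not an integer, and this is what makes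
  the digit independent of the chosen expansion: the digits up to position \<open>k\<close> form an integer \<open>D\<close>
  with \<open>D \<le> b ^ k * x \<le> D + 1\<close>, where the upper bound is attained if only digits \<open>b - 1\<close> follow.
\<close>

lemma expansion_digit_eq:
  fixes d :: "nat \<Rightarrow> nat"
  assumes exp: "is_expansion b x d" and b: "b \<ge> 2" and k: "k \<ge> 1"
    and lower: "real N < real b ^ k * x" and upper: "real b ^ k * x < real N + 1"
  shows "d k = N mod b"
proof -
  have digit: "d (Suc i) < b" for i
    using exp by (auto simp: is_expansion_def)
  define f where "f i = real (d (Suc i)) / real b ^ Suc i" for i
  have f_sums: "f sums x"
    using exp unfolding is_expansion_def f_def by (rule conjunct2)
  define D where "D = (\<Sum>i<k. d (Suc i) * b ^ (k - Suc i))"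
  define R where "R = (\<Sum>i. f (i + k))"
  have x_eq: "x = R + (\<Sum>i<k. f i)"
    using f_sums suminf_split_initial_segment[of f k] by (simp add: R_def sums_iff)
  have "real b ^ k * f i = real (d (Suc i) * b ^ (k - Suc i))" if "i < k" for i
  proof -
    have "real b ^ k = real b ^ Suc i * real b ^ (k - Suc i)"
      using that by (simp flip: power_add del: power_Suc)
    then show ?thesis using b by (simp add: f_def)
  qed
  then have "real b ^ k * (\<Sum>i<k. f i) = real D"
    by (simp add: D_def sum_distrib_left)
  then have split: "real b ^ k * x = real b ^ k * R + real D"
    by (simp add: x_eq distrib_left)
  have f_tail: "summable (\<lambda>i. f (i + k))"
    using f_sums by (simp add: sums_iff)
  have geom: "(\<lambda>i. (real b - 1) / real b ^ Suc k * (1 / real b) ^ i) sums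
      ((real b - 1) / real b ^ Suc k * (1 / (1 - 1 / real b)))"
    using b by (intro sums_mult geometric_sums) auto
  have geom_value: "(real b - 1) / real b ^ Suc k * (1 / (1 - 1 / real b)) = 1 / real b ^ k"
    using b by (simp add: field_simps)
  have "R \<ge> 0"
    unfolding R_def using f_tail by (rule suminf_nonneg) (simp add: f_def)
  have "f (i + k) \<le> (real b - 1) / real b ^ Suc k * (1 / real b) ^ i" for i
  proof -
    have "real (d (Suc (i + k))) \<le> real b - 1"
      using digit[of "i + k"] b by linarith
    then have "f (i + k) \<le> (real b - 1) / real b ^ Suc (i + k)"
      unfolding f_def by (intro divide_right_mono) auto
    then show ?thesis by (simp add: power_add power_divide mult_ac)
  qed
  then have "R \<le> 1 / real b ^ k"
    unfolding R_def using geom geom_value f_tail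
    by (metis (no_types, lifting) sums_le summable_sums)
  then have "real b ^ k * R \<le> 1"
    using b by (simp add: field_simps)
  have "real b ^ k * R \<ge> 0"
    using \<open>R \<ge> 0\<close> by simp
  then have "D = N"
    using split lower upper \<open>real b ^ k * R \<le> 1\<close> by linarith
  obtain l where l: "k = Suc l"
    using k by (cases k) auto
  have "b dvd (\<Sum>i<l. d (Suc i) * b ^ (k - Suc i))"
    by (intro dvd_sum dvd_mult dvd_power) (auto simp: l)
  moreover have "D = d k + (\<Sum>i<l. d (Suc i) * b ^ (k - Suc i))"
    by (simp add: D_def l)
  ultimately have "D mod b = d k mod b"
    by (metis dvd_def mod_mult_self2)
  then show ?thesis
    using digit[of l] \<open>D = N\<close> l by simp
qed


section \<open>Powers of 4 modulo powers of 3\<close>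

lemma power_4_mod_3: "(4::nat) ^ a mod 3 = 1"
  using power_mod[of "4 :: nat" 3 a] by simp

text \<open>
  This says that 4 has order \<open>3 ^ n\<close> modulo \<open>3 ^ (n + 1)\<close>. Each step gains one factor 3 because
  \<open>x ^ 3 - 1 = (x - 1) * (x\<^sup>2 + x + 1)\<close>, and for \<open>x\<close> congruent to 1 modulo 3 the second factor is
  divisible by 3 but not by 9. That the exponent must be a multiple of 3 is seen modulo 9.
\<close>

lemma power_3_dvd_power_4_minus_1_iff:
  "(3::int) ^ Suc n dvd 4 ^ a - 1 \<longleftrightarrow> 3 ^ n dvd a"
proof (induction n arbitrary: a)
  case 0
  have "(4::int) ^ a mod 3 = 1"
    using arg_cong[OF power_4_mod_3[of a], of int] by (simp add: zmod_int)
  then show ?case by (simp add: mod_eq_dvd_iff[symmetric])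
next
  case (Suc n)
  have cube: "(3::int) ^ Suc (Suc n) dvd 4 ^ (3 * b) - 1 \<longleftrightarrow> 3 ^ n dvd b" for b
  proof -
    define x :: int where "x = 4 ^ b"
    have "x mod 3 = 1"
      using arg_cong[OF power_4_mod_3[of b], of int] by (simp add: x_def zmod_int)
    then obtain y where y: "x = 1 + 3 * y"
      by (metis mult_div_mod_eq add.commute)
    have "(4::int) ^ (3 * b) - 1 = x ^ 3 - 1"
      by (simp add: x_def mult.commute flip: power_mult)
    also have "\<dots> = 3 * ((x - 1) * (1 + 3 * (y + y ^ 2)))"
      by (simp add: y power2_eq_square power3_eq_cube algebra_simps)
    finally have factored: "(4::int) ^ (3 * b) - 1 = 3 * ((x - 1) * (1 + 3 * (y + y ^ 2)))" .
    have "coprime (1 + 3 * (y + y ^ 2)) (3::int)"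
    proof (rule coprimeI)
      fix c :: int
      assume "c dvd 1 + 3 * (y + y ^ 2)" "c dvd 3"
      then show "is_unit c"
        by (metis dvd_add_left_iff dvd_mult2)
    qed
    then have "coprime ((3::int) ^ Suc n) (1 + 3 * (y + y ^ 2))"
      by (simp add: coprime_commute)
    then show ?thesis
      unfolding factored power_Suc[of 3 "Suc n"] using Suc.IH[of b]
      by (simp only: x_def dvd_mult_cancel_left coprime_dvd_mult_left_iff) simp
  qed
  show ?case
  proof (cases "3 dvd a")
    case True
    then obtain b where "a = 3 * b" by (elim dvdE)
    then show ?thesis using cube[of b] by simp
  next
    case False
    have period_9: "(64::int) ^ b mod 9 = 1" for b
      using power_mod[of "64 :: int" 9 b] by simp
    have "(4::int) ^ a = 4 ^ (3 * (a div 3) + a mod 3)" by simp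
    also have "\<dots> = 64 ^ (a div 3) * 4 ^ (a mod 3)"
      by (simp only: power_add power_mult) simp
    finally have "(4::int) ^ a mod 9 = 4 ^ (a mod 3) mod 9"
      using period_9[of "a div 3"] by (metis mod_mult_left_eq mult_1)
    moreover have "a mod 3 = 1 \<or> a mod 3 = 2"
      using False by presburger
    ultimately have "\<not> (9::int) dvd 4 ^ a - 1"
      by (auto simp: mod_eq_dvd_iff[symmetric])
    moreover have "(9::int) dvd 3 ^ Suc (Suc n)" by simp
    moreover have "\<not> 3 ^ Suc n dvd a"
      using False by (metis dvd_mult_left power_Suc)
    ultimately show ?thesis by (meson dvd_trans)
  qed
qed

text \<open>
  The residues on the left are distinct by the order of 4, and lie among the numbers \<open>3 * j + 2\<close>
  because 4 is 1 modulo 3; comparing cardinalities, they are a rearrangement of those numbers.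
\<close>

lemma sum_residues_times_powers_of_4:
  assumes A: "A mod 3 = 2"
  shows "(\<Sum>i<3 ^ n. f (A * 4 ^ i mod 3 ^ Suc n)) = (\<Sum>j<3 ^ n. f (3 * j + 2 :: nat))"
proof -
  define g where "g i = A * 4 ^ i mod 3 ^ Suc n" for i
  have inj: "inj_on g {..<3 ^ n}"
  proof (rule linorder_inj_onI)
    fix i j :: nat
    assume ij: "i < j" "i \<in> {..<3 ^ n}" "j \<in> {..<3 ^ n}"
    show "g i \<noteq> g j"
    proof
      assume "g i = g j"
      then have "int (A * 4 ^ j) mod int (3 ^ Suc n) = int (A * 4 ^ i) mod int (3 ^ Suc n)"
        unfolding g_def by (simp only: zmod_int[symmetric])
      then have "int (3 ^ Suc n) dvd int (A * 4 ^ j) - int (A * 4 ^ i)"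
        by (simp only: mod_eq_dvd_iff)
      also have "int (A * 4 ^ j) - int (A * 4 ^ i) = (int A * 4 ^ i) * (4 ^ (j - i) - 1)"
        using ij by (simp add: algebra_simps flip: power_add)
      finally have "3 ^ Suc n dvd (int A * 4 ^ i) * (4 ^ (j - i) - 1)" by simp
      moreover have "coprime (3 ^ Suc n) (int A * 4 ^ i)"
      proof -
        have "coprime 3 (4 :: int)" 
          by (rule coprimeI) (use dvd_diff[of _ "4 :: int" 3] in simp)
        moreover have "coprime 3 (int A)"
        proof (rule coprimeI)
          fix c :: int
          assume c: "c dvd 3" "c dvd int A"
          have "3 * int (A div 3 + 1) - int A = 1" using A by presburger
          then show "is_unit c" using c by (metis dvd_diff dvd_mult2)
        qed
        ultimately show ?thesis by simp
      qed
      ultimately have "(3::int) ^ Suc n dvd 4 ^ (j - i) - 1"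
        by (simp only: coprime_dvd_mult_right_iff)
      then have "3 ^ n dvd j - i" by (simp only: power_3_dvd_power_4_minus_1_iff)
      then show False using ij by (auto dest: dvd_imp_le)
    qed
  qed auto
  have "g ` {..<3 ^ n} = (\<lambda>j. 3 * j + 2) ` {..<3 ^ n}"
  proof (rule card_subset_eq)
    show "g ` {..<3 ^ n} \<subseteq> (\<lambda>j. 3 * j + 2) ` {..<3 ^ n}"
    proof (rule image_subsetI)
      fix i :: nat
      have "A * 4 ^ i mod 3 = 2"
        using A power_4_mod_3[of i] by (metis mod_mult_eq mult.right_neutral mod_mod_trivial)
      then have "g i mod 3 = 2"
        unfolding g_def by (simp add: mod_mod_cancel)
      moreover have "g i < 3 * 3 ^ n" by (simp add: g_def)
      ultimately show "g i \<in> (\<lambda>j. 3 * j + 2) ` {..<3 ^ n}"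
        by (intro image_eqI[of _ _ "g i div 3"]) (simp_all, presburger+)
    qed
    show "card (g ` {..<3 ^ n}) = card ((\<lambda>j. 3 * j + 2) ` {..<3 ^ n :: nat})"
      using inj by (simp add: card_image inj_on_def)
  qed simp
  then have "(\<Sum>i<3 ^ n. f (g i)) = sum f ((\<lambda>j. 3 * j + 2) ` {..<3 ^ n})"
    using inj by (metis (no_types, lifting) sum.reindex_cong)
  also have "\<dots> = (\<Sum>j<3 ^ n. f (3 * j + 2))"
    by (rule sum.reindex_cong[where l = "\<lambda>j. 3 * j + 2"]) (auto simp: inj_on_def)
  finally show ?thesis by (simp add: g_def)
qed

section \<open>The expansion of the Stoneham number inside a block\<close>

text \<open>
  The left side is the first base-4 digit after the point of \<open>P / M\<close>, which depends only on the
  fractional part.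
\<close>

lemma digit_of_fraction:
  fixes P M :: nat
  assumes "M > 0"
  shows "(4 * P div M) mod 4 = 4 * (P mod M) div M"
proof -
  have "4 * P div M = (4 * (P mod M) + 4 * (P div M) * M) div M"
    by (metis add.commute distrib_left mult.assoc mult.commute mult_div_mod_eq)
  also have "\<dots> = 4 * (P mod M) div M + 4 * (P div M)"
    using assms by simp
  finally have "(4 * P div M) mod 4 = (4 * (P mod M) div M) mod 4"
    by simp
  moreover have "4 * (P mod M) div M < 4"
    using assms by (simp add: less_mult_imp_div_less)
  ultimately show ?thesis by simp
qed

text \<open>
  The numerator of the partial sum of \<open>n + 1\<close> terms over the denominator
  \<open>3 ^ (n + 1) * 2 ^ (3 ^ (n + 1) + 1)\<close>. The superfluous factor 2 is there because
  \<open>2 * (block_start n - 1) = 3 ^ (n + 1) + 1\<close>, so that scaling to the start of the block cancels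
  the power of two exactly.
\<close>

definition stoneham_numerator :: "nat \<Rightarrow> nat" where
  "stoneham_numerator n = (\<Sum>m\<le>n. 2 ^ (3 ^ Suc n + 1 - 3 ^ Suc m) * 3 ^ (n - m))"

text \<open>Only the term for \<open>m = n\<close> is not divisible by 3, and it is the superfluous factor 2.\<close>

lemma stoneham_numerator_mod_3: "stoneham_numerator n mod 3 = 2"
proof -
  have "3 dvd (\<Sum>m<n. 2 ^ (3 ^ Suc n + 1 - 3 ^ Suc m) * (3::nat) ^ (n - m))"
    by (intro dvd_sum dvd_mult dvd_power) auto
  moreover have "stoneham_numerator n =
      (\<Sum>m<n. 2 ^ (3 ^ Suc n + 1 - 3 ^ Suc m) * 3 ^ (n - m)) + 2"
    unfolding stoneham_numerator_def by (simp add: lessThan_Suc_atMost[symmetric])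
  ultimately show ?thesis by presburger
qed

text \<open>
  The remainder is compared with the geometric series of ratio 1/6 that starts at its first term;
  its sum is 6/5 times that term. Any factor below 3/2 would do for the estimate of the last digit
  of a block, so a ratio of 1/3, coming from the powers of 3 alone, would just fail.
\<close>

lemma stoneham_split:
  obtains T where
    "stoneham 2 3 = real (stoneham_numerator n) / (3 ^ Suc n * 2 ^ (3 ^ Suc n + 1)) + T"
    "0 < T" "T \<le> 6 / 5 / (3 ^ (n + 2) * 2 ^ 3 ^ (n + 2))"
proof -
  define f :: "nat \<Rightarrow> real" where "f m = 1 / (3 ^ Suc m * 2 ^ 3 ^ Suc m)" for m
  define F where "F = f (Suc n)"
  have bound: "f (m + Suc n) \<le> F * (1 / 6) ^ m" for m
  proof -
    have "3 ^ (n + 2) + m \<le> (3::nat) ^ (m + n + 2)"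
    proof (induction m)
      case (Suc m)
      moreover have "(1::nat) \<le> 3 ^ (m + n + 2)" by simp
      moreover have "(3::nat) ^ (Suc m + n + 2) = 3 * 3 ^ (m + n + 2)" by simp
      ultimately show ?case by linarith
    qed simp
    then have "(2::real) ^ (3 ^ (n + 2) + m) \<le> 2 ^ 3 ^ (m + n + 2)"
      by (intro power_increasing) auto
    then have "3 ^ (m + n + 2) * (2::real) ^ (3 ^ (n + 2) + m) \<le> 3 ^ (m + n + 2) * 2 ^ 3 ^ (m + n + 2)"
      by (intro mult_left_mono) auto
    then have "f (m + Suc n) \<le> 1 / (3 ^ (m + n + 2) * (2::real) ^ (3 ^ (n + 2) + m))"
      unfolding f_def by (intro divide_left_mono) auto
    also have "\<dots> = F * (1 / 6) ^ m"
    proof -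
      have "(6::real) ^ m = 3 ^ m * 2 ^ m" by (simp flip: power_mult_distrib)
      then show ?thesis by (simp add: F_def f_def power_add power_divide)
    qed
    finally show ?thesis .
  qed
  have f_pos: "f m > 0" for m by (simp add: f_def)
  have geom: "(\<lambda>m. F * (1 / 6) ^ m) sums (F * (1 / (1 - 1 / 6)))"
    by (intro sums_mult geometric_sums) auto
  have tail: "summable (\<lambda>m. f (m + Suc n))"
    using bound f_pos by (intro summable_comparison_test'[OF sums_summable[OF geom], of 0])
      (auto simp: less_imp_le)
  then have "summable f" by (simp only: summable_iff_shift)
  define T where "T = (\<Sum>m. f (m + Suc n))"
  have "stoneham 2 3 = suminf f"
    unfolding stoneham_def f_def by simp
  also have "\<dots> = T + (\<Sum>m<Suc n. f m)"
    unfolding T_def using \<open>summable f\<close> by (rule suminf_split_initial_segment)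
  also have "(\<Sum>m<Suc n. f m) = real (stoneham_numerator n) / (3 ^ Suc n * 2 ^ (3 ^ Suc n + 1))"
  proof -
    have "f m = real (2 ^ (3 ^ Suc n + 1 - 3 ^ Suc m) * 3 ^ (n - m)) /
        (3 ^ Suc n * 2 ^ (3 ^ Suc n + 1))" if "m \<le> n" for m
    proof -
      have "(3::nat) ^ Suc m \<le> 3 ^ Suc n" using that by (intro power_increasing) auto
      then have "(3::nat) ^ Suc n + 1 = (3 ^ Suc n + 1 - 3 ^ Suc m) + 3 ^ Suc m"
        by linarith
      then have "(2::real) ^ (3 ^ Suc n + 1) = 2 ^ (3 ^ Suc n + 1 - 3 ^ Suc m) * 2 ^ 3 ^ Suc m"
        by (metis power_add)
      moreover have "(3::real) ^ Suc n = 3 ^ (n - m) * 3 ^ Suc m"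
        using that by (simp flip: power_add del: power_Suc)
      ultimately show ?thesis
        unfolding f_def by (simp del: power_Suc)
    qed
    then show ?thesis
      by (simp add: stoneham_numerator_def lessThan_Suc_atMost sum_divide_distrib del: power_Suc)
  qed
  finally have eq: "stoneham 2 3 =
      real (stoneham_numerator n) / (3 ^ Suc n * 2 ^ (3 ^ Suc n + 1)) + T" by simp
  have "T > 0" unfolding T_def using tail f_pos by (intro suminf_pos)
  moreover have "T \<le> F * (1 / (1 - 1 / 6))"
    unfolding T_def using sums_le[OF bound summable_sums[OF tail] geom] .
  ultimately show ?thesis using eq by (intro that) (auto simp: F_def f_def)
qed

text \<open>
  After scaling by \<open>4 ^ k\<close>, the remainder of the series is positive and smaller than the distance
  of the main fraction from the next integer, so it moves the value strictly between two integers
  without changing the integer part.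
\<close>

lemma block_digit:
  assumes d: "is_expansion 4 (stoneham 2 3) d" and i: "i < 3 ^ Suc n"
  shows "d (block_start n + i) = 4 * (stoneham_numerator n * 4 ^ i mod 3 ^ Suc n) div 3 ^ Suc n"
proof -
  define A where "A = stoneham_numerator n"
  define M :: nat where "M = 3 ^ Suc n"
  obtain T where T: "stoneham 2 3 = real A / (3 ^ Suc n * 2 ^ (3 ^ Suc n + 1)) + T"
    "0 < T" "T \<le> 6 / 5 / (3 ^ (n + 2) * 2 ^ 3 ^ (n + 2))"
    unfolding A_def by (rule stoneham_split)
  define k where "k = block_start n + i"
  have two_k: "2 * k = 2 + (3 ^ Suc n + 1) + 2 * i"
    using two_times_block_start[of n] by (simp add: k_def)
  have "(4::real) ^ k = 2 ^ (2 * k)"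
    by (simp add: power_mult)
  also have "\<dots> = 2\<^sup>2 * 2 ^ (3 ^ Suc n + 1) * (2\<^sup>2) ^ i"
    unfolding two_k by (simp only: power_add power_mult)
  also have "\<dots> = 4 * 4 ^ i * 2 ^ (3 ^ Suc n + 1)"
    by simp
  finally have power_k: "(4::real) ^ k = 4 * 4 ^ i * 2 ^ (3 ^ Suc n + 1)" .
  define P where "P = 4 * (A * 4 ^ i)"
  have scaled: "4 ^ k * stoneham 2 3 = real P / real M + 4 ^ k * T"
    unfolding T(1) distrib_left P_def M_def unfolding power_k by (simp del: power_Suc)
  have tail_pos: "4 ^ k * T > 0" using T by simp
  have tail: "4 ^ k * T < 1 / real M"
  proof -
    \<comment> \<open>The worst case is the last position of the block, where the bound is attained.\<close>
    have "2 * k \<le> 3 ^ (n + 2) + 1"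
      using i unfolding two_k by simp
    then have "(2::real) ^ (2 * k) \<le> 2 ^ (3 ^ (n + 2) + 1)"
      by (intro power_increasing) auto
    then have "(4::real) ^ k \<le> 2 * 2 ^ 3 ^ (n + 2)"
      by (simp add: power_mult)
    then have "4 ^ k * T \<le> (2 * 2 ^ 3 ^ (n + 2)) * (6 / 5 / (3 ^ (n + 2) * 2 ^ 3 ^ (n + 2)))"
      using T by (intro mult_mono) auto
    also have "\<dots> = 12 / 15 / real M" by (simp add: M_def field_simps)
    also have "\<dots> < 1 / real M" by (simp add: M_def field_simps)
    finally show ?thesis .
  qed
  have M: "real M > 0" by (simp add: M_def)
  have div_mod: "real P / real M = real (P div M) + real (P mod M) / real M"
  proof -
    have "real P = real (P div M) * real M + real (P mod M)"
      by (simp flip: of_nat_mult of_nat_add)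
    then show ?thesis using M by (simp add: field_simps)
  qed
  have "P mod M + 1 \<le> M" using M by (simp add: Suc_leI)
  then have "real (P mod M) / real M + 1 / real M \<le> 1"
    using M by (simp add: field_simps)
  then have upper: "4 ^ k * stoneham 2 3 < real (P div M) + 1"
    using scaled tail div_mod by linarith
  have "real (P mod M) / real M \<ge> 0" by simp
  then have lower: "real (P div M) < 4 ^ k * stoneham 2 3"
    using scaled tail_pos div_mod by linarith
  have "k \<ge> 1" using two_k by linarith
  then have "d k = P div M mod 4"
    using lower upper by (intro expansion_digit_eq[OF d]) auto
  also have "\<dots> = 4 * (A * 4 ^ i mod M) div M"
    unfolding P_def using M by (intro digit_of_fraction) simp
  finally show ?thesis by (simp add: k_def A_def M_def)
qed

lemma block_digit_periodic:
  assumes d: "is_expansion 4 (stoneham 2 3) d" and i: "i + 3 ^ n < 3 ^ Suc n"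
  shows "d (block_start n + (i + 3 ^ n)) = d (block_start n + i)"
proof -
  have "(3::int) ^ Suc n dvd 4 ^ 3 ^ n - 1"
    by (simp only: power_3_dvd_power_4_minus_1_iff dvd_refl)
  then have "(4::nat) ^ 3 ^ n mod 3 ^ Suc n = 1 mod 3 ^ Suc n"
    by (simp only: mod_eq_dvd_iff[symmetric] of_nat_eq_iff[where 'a=int, symmetric] zmod_int
        of_nat_power of_nat_numeral of_nat_1)
  then have "stoneham_numerator n * 4 ^ (i + 3 ^ n) mod 3 ^ Suc n =
      stoneham_numerator n * 4 ^ i mod 3 ^ Suc n"
    unfolding power_add mult.assoc[symmetric] by (metis mod_mult_right_eq mult.right_neutral)
  then show ?thesis
    using i by (simp only: block_digit[OF d] block_digit[OF d, of i n])
qed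

section \<open>Counting the digits of a period\<close>

text \<open>
  The digit of \<open>j\<close> is \<open>e\<close> when \<open>3 * j + 2\<close> lies in the quarter number \<open>e\<close> of the interval from 0
  to \<open>3 * q\<close>, so the digits increase with \<open>j\<close> and it suffices to find where they jump.
\<close>

lemma sum_i_power_quartiles:
  fixes q :: nat
  assumes q: "q mod 4 = 1 \<or> q mod 4 = 3"
  shows "(\<Sum>j<q. \<i> ^ (4 * (3 * j + 2) div (3 * q))) = - (if q mod 4 = 3 then \<i> else 1)"
proof -
  define D where "D j = 4 * (3 * j + 2) div (3 * q)" for j
  define t where "t = q div 4"
  have part: "(\<Sum>j\<in>{a..<b}. \<i> ^ D j) = of_nat (b - a) * \<i> ^ e"
    if "\<And>j. a \<le> j \<Longrightarrow> j < b \<Longrightarrow> 3 * q * e \<le> 4 * (3 * j + 2) \<and> 4 * (3 * j + 2) < 3 * q * Suc e"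
    for a b e
  proof -
    have "D j = e" if "j \<in> {a..<b}" for j
      unfolding D_def using that \<open>\<And>j. a \<le> j \<Longrightarrow> j < b \<Longrightarrow> _\<close>[of j]
      by (intro div_nat_eqI) (auto simp: mult.commute)
    then show ?thesis by simp
  qed
  have concat: "(\<Sum>j<q. \<i> ^ D j) = (\<Sum>j\<in>{0..<a}. \<i> ^ D j) + (\<Sum>j\<in>{a..<b}. \<i> ^ D j)
      + (\<Sum>j\<in>{b..<c}. \<i> ^ D j) + (\<Sum>j\<in>{c..<q}. \<i> ^ D j)" if "a \<le> b" "b \<le> c" "c \<le> q" for a b c
    using that by (simp add: sum.atLeastLessThan_concat lessThan_atLeast0)
  show ?thesis
  proof (cases "q mod 4 = 3")
    case False
    \<comment> \<open>The digits 0, 1, 2, 3 occur \<open>t\<close>, \<open>t\<close>, \<open>t + 1\<close>, \<open>t\<close> times.\<close>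
    then have qt: "q = 4 * t + 1" using q unfolding t_def by presburger
    have "(\<Sum>j\<in>{0..<t}. \<i> ^ D j) = of_nat (t - 0) * \<i> ^ 0"
      by (rule part) (use qt in auto)
    moreover
    have "(\<Sum>j\<in>{t..<2 * t}. \<i> ^ D j) = of_nat (2 * t - t) * \<i> ^ 1"
      by (rule part) (use qt in auto)
    moreover
    have "(\<Sum>j\<in>{2 * t..<3 * t + 1}. \<i> ^ D j) = of_nat (3 * t + 1 - (2 * t)) * \<i> ^ 2"
      by (rule part) (use qt in auto)
    moreover
    have "(\<Sum>j\<in>{3 * t + 1..<q}. \<i> ^ D j) = of_nat (q - (3 * t + 1)) * \<i> ^ 3"
      by (rule part) (use qt in auto)
    ultimately have "(\<Sum>j<q. \<i> ^ D j) = of_nat (t - 0) * \<i> ^ 0 + of_nat (2 * t - t) * \<i> ^ 1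
        + of_nat (3 * t + 1 - (2 * t)) * \<i> ^ 2 + of_nat (q - (3 * t + 1)) * \<i> ^ 3"
      using concat[of "t" "2 * t" "3 * t + 1"] qt by simp
    also have "\<dots> = -1" by (simp add: qt algebra_simps power3_eq_cube)
    finally show ?thesis using False by (simp add: D_def)
  next
    case True
    \<comment> \<open>The digits 0, 1, 2, 3 occur \<open>t + 1\<close>, \<open>t\<close>, \<open>t + 1\<close>, \<open>t + 1\<close> times.\<close>
    then have qt: "q = 4 * t + 3" unfolding t_def by presburger
    have "(\<Sum>j\<in>{0..<t + 1}. \<i> ^ D j) = of_nat (t + 1 - 0) * \<i> ^ 0"
      by (rule part) (use qt in auto)
    moreover
    have "(\<Sum>j\<in>{t + 1..<2 * t + 1}. \<i> ^ D j) = of_nat (2 * t + 1 - (t + 1)) * \<i> ^ 1"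
      by (rule part) (use qt in auto)
    moreover
    have "(\<Sum>j\<in>{2 * t + 1..<3 * t + 2}. \<i> ^ D j) = of_nat (3 * t + 2 - (2 * t + 1)) * \<i> ^ 2"
      by (rule part) (use qt in auto)
    moreover
    have "(\<Sum>j\<in>{3 * t + 2..<q}. \<i> ^ D j) = of_nat (q - (3 * t + 2)) * \<i> ^ 3"
      by (rule part) (use qt in auto)
    ultimately have "(\<Sum>j<q. \<i> ^ D j) = of_nat (t + 1 - 0) * \<i> ^ 0 + of_nat (2 * t + 1 - (t + 1)) * \<i> ^ 1
        + of_nat (3 * t + 2 - (2 * t + 1)) * \<i> ^ 2 + of_nat (q - (3 * t + 2)) * \<i> ^ 3"
      using concat[of "t + 1" "2 * t + 1" "3 * t + 2"] qt by simp
    also have "\<dots> = - \<i>" by (simp add: qt algebra_simps power3_eq_cube)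
    finally show ?thesis using True by (simp add: D_def)
  qed
qed

lemma power_3_mod_4: "3 ^ n mod 4 = (if odd n then 3 else 1 :: nat)"
proof (induction n)
  case (Suc n)
  have "(3::nat) ^ Suc n mod 4 = 3 * (3 ^ n mod 4) mod 4"
    by (simp add: mod_mult_right_eq)
  then show ?case by (simp add: Suc del: power_Suc)
qed simp

theorem theorem1p1:
  fixes d :: "nat \<Rightarrow> nat" and n :: nat
  assumes "is_expansion 4 (stoneham 2 3) d"
  shows "(\<Sum>k = block_start n..block_start n + 3 ^ n - 1. exp (of_real pi * \<i> / 2) ^ d k)
           = - (if odd n then \<i> else 1)
         \<and> (\<forall>k \<in> {block_start n..block_start n + 3 ^ n - 1}.
              d k = d (3 ^ n + k) \<and> d (3 ^ n + k) = d (2 * 3 ^ n + k))"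
proof (intro conjI ballI)
  define A where "A = stoneham_numerator n"
  have period_pos: "(3::nat) ^ n > 0" by simp
  have range: "{block_start n..block_start n + 3 ^ n - 1} = (\<lambda>i. block_start n + i) ` {..<3 ^ n}"
  proof -
    have "{block_start n..block_start n + 3 ^ n - 1} = {block_start n..<block_start n + 3 ^ n}"
      using period_pos by (intro set_eqI) (simp only: atLeastAtMost_iff atLeastLessThan_iff, linarith)
    then show ?thesis by (simp add: lessThan_atLeast0 add.commute)
  qed
  have "exp (of_real pi * \<i> / 2) = \<i>"
    using cis_pi_half by (simp add: cis_conv_exp mult.commute)
  then have "(\<Sum>k = block_start n..block_start n + 3 ^ n - 1. exp (of_real pi * \<i> / 2) ^ d k)
      = (\<Sum>i<3 ^ n. \<i> ^ d (block_start n + i))"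
    unfolding range by (subst sum.reindex) (auto simp: inj_on_def)
  also have "\<dots> = (\<Sum>i<3 ^ n. \<i> ^ (4 * (A * 4 ^ i mod 3 ^ Suc n) div 3 ^ Suc n))"
    using block_digit[OF assms] by (intro sum.cong) (auto simp: A_def)
  also have "\<dots> = (\<Sum>j<3 ^ n. \<i> ^ (4 * (3 * j + 2) div (3 * 3 ^ n)))"
    using sum_residues_times_powers_of_4[of A "\<lambda>r. \<i> ^ (4 * r div 3 ^ Suc n)" n]
    by (simp add: A_def stoneham_numerator_mod_3)
  also have "\<dots> = - (if odd n then \<i> else 1)"
    by (subst sum_i_power_quartiles) (auto simp: power_3_mod_4)
  finally show "(\<Sum>k = block_start n..block_start n + 3 ^ n - 1. exp (of_real pi * \<i> / 2) ^ d k)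
      = - (if odd n then \<i> else 1)" .
  fix k
  assume "k \<in> {block_start n..block_start n + 3 ^ n - 1}"
  then obtain i where i: "k = block_start n + i" "i < 3 ^ n"
    unfolding range by auto
  show "d k = d (3 ^ n + k)"
    using block_digit_periodic[OF assms, of i n] i by (simp add: ac_simps)
  show "d (3 ^ n + k) = d (2 * 3 ^ n + k)"
    using block_digit_periodic[OF assms, of "i + 3 ^ n" n] i by (simp add: ac_simps mult_2)
qed

end
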